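(* Let $G$ be a group acting on a countable set $X$. The following conditions are equivalent: (i) there exists a $G$-invariant locally finite metric $d$ on $X$; (ii) the orbits of all the stabilizers of the $G$-action are finite, that is, for all $x,y\in X$ the set $G_x y=\{gy : g\in G,\ gx=x\}$ is finite.
   Context: For $x\in X$, $G_x=\{g\in G : gx=x\}$ denotes the stabilizer of $x$. A metric $d$ on $X$ is $G$-invariant if $d(gx,gy)=d(x,y)$ for all $g\in G$ and $x,y\in X$. A metric on $X$ is locally finite if it induces the discrete topology on $X$ and is proper, i.e. all closed balls $\{y : d(x,y)\le r\}$ are compact (hence finite). *)

theory Defs
  imports "HOL-Analysis.Analysis" "HOL-Algebra.Group_Action"
begin

definition locally_finite_metric :: "'a set \<Rightarrow> ('a \<Rightarrow> 'a \<Rightarrow> real) \<Rightarrow> bool"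
  where "locally_finite_metric X d \<longleftrightarrow>
    Metric_space X d \<and>
    Metric_space.mtopology X d = discrete_topology X \<and>
    (\<forall>x\<in>X. \<forall>r. compactin (Metric_space.mtopology X d) (Metric_space.mcball X d x r))"

definition invariant_metric ::
  "('g, 'm) monoid_scheme \<Rightarrow> ('g \<Rightarrow> 'a \<Rightarrow> 'a) \<Rightarrow> 'a set \<Rightarrow> ('a \<Rightarrow> 'a \<Rightarrow> real) \<Rightarrow> bool"
  where "invariant_metric G \<phi> X d \<longleftrightarrow>
    Metric_space X d \<and>
    (\<forall>g\<in>carrier G. \<forall>x\<in>X. \<forall>y\<in>X. d (\<phi> g x) (\<phi> g y) = d x y)"

end

theory Submission
  imports Defs
begin

text \<open>
  If an invariant locally finite metric exists, the orbit of \<open>y\<close> under the stabilizer of \<open>x\<close> stays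
  in the closed ball around \<open>x\<close> of radius \<open>d x y\<close>, a compact set in a discrete space.

  For the converse, fix an enumeration \<open>f\<close> of \<open>X\<close> and let \<open>K n\<close> relate \<open>x\<close> and \<open>y\<close> if they are equal or
  if one group element moves both of them into the finite set of points of index below \<open>n\<close>. These
  symmetric, invariant relations increase with \<open>n\<close> and exhaust \<open>X \<times> X\<close>. If all stabilizer orbits
  are finite, each \<open>K n\<close> relates a point to finitely many others only: a group element carrying \<open>x\<close>
  to a prescribed point is determined up to the stabilizer of \<open>x\<close>, so the preimage of another
  prescribed point ranges over a single stabilizer orbit.

  The relations \<open>K n\<close> obey no triangle inequality, but their powers \<open>K n ^^ n\<close> do: a chain of \<open>m\<close>
  steps in \<open>K m\<close> followed by one of \<open>n\<close> steps in \<open>K n\<close> is a chain of \<open>m + n\<close> steps in \<open>K (m + n)\<close>.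
  Hence the least \<open>n\<close> with \<open>(x, y) \<in> K n ^^ n\<close> is a metric with values in the natural numbers. Its
  balls are finite, because powers of relations with finite fibres have finite fibres.
\<close>

section \<open>Powers of relations\<close>

lemma finite_Image_relpow:
  fixes R :: "('a \<times> 'a) set"
  assumes "\<And>x. finite (R `` {x})"
  shows "finite ((R ^^ n) `` {x})"
proof (induction n)
  case (Suc n)
  have "(R ^^ Suc n) `` {x} = (\<Union>y\<in>(R ^^ n) `` {x}. R `` {y})"
    by auto
  then show ?case
    using Suc assms by simp
qed auto

lemma relpow_image:
  assumes "(x, y) \<in> R ^^ n" and "\<And>u v. (u, v) \<in> R \<Longrightarrow> (h u, h v) \<in> S"
  shows "(h x, h y) \<in> S ^^ n"
  using assms(1)
  by (induction n arbitrary: y) (auto intro: assms(2))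

lemma sym_relpow:
  assumes "sym R"
  shows "sym (R ^^ n)"
proof (induction n)
  case (Suc n)
  have "(y, x) \<in> R ^^ Suc n" if "(x, y) \<in> R ^^ Suc n" for x y
    using that Suc assms by (metis relpow_Suc_E relpow_Suc_I2 symD)
  then show ?case
    by (blast intro: symI)
qed (simp add: sym_Id)

section \<open>The metric of a locally finite exhaustion\<close>

text \<open>
  The metric is built without a group. An exhaustion by invariant relations yields an invariant
  metric, since a group element maps chains to chains of the same length.
\<close>

locale locally_finite_exhaustion =
  fixes X :: "'a set" and K :: "nat \<Rightarrow> ('a \<times> 'a) set"
  assumes refl: "x \<in> X \<Longrightarrow> (x, x) \<in> K n"
    and sym: "sym (K n)"
    and mono: "mono K"
    and finite_fibre: "finite (K n `` {x})"
    and exhausting: "x \<in> X \<Longrightarrow> y \<in> X \<Longrightarrow> \<exists>n. (x, y) \<in> K n"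
begin

text \<open>
  The index \<open>n\<close> bounds both the number of steps and the width of each step. This double role
  makes the powers \<open>K n ^^ n\<close> compose with additive indices.
\<close>

definition chain_dist :: "'a \<Rightarrow> 'a \<Rightarrow> nat"
  where "chain_dist x y = (LEAST n. (x, y) \<in> K n ^^ n)"

lemma chain_dist_le: "(x, y) \<in> K n ^^ n \<Longrightarrow> chain_dist x y \<le> n"
  unfolding chain_dist_def by (rule Least_le)

lemma chain_dist_attained:
  assumes "x \<in> X" "y \<in> X"
  shows "(x, y) \<in> K (chain_dist x y) ^^ chain_dist x y"
proof -
  obtain n where "(x, y) \<in> K n"
    using exhausting assms by blast
  \<comment> \<open>The index is raised by one so that the chain may have a step even if \<open>n = 0\<close>; the remaining
     steps rest at \<open>x\<close>.\<close>
  then have "(x, y) \<in> K (Suc n)"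
    using mono by (auto dest: monoD[of K n "Suc n"])
  moreover have "(x, x) \<in> K (Suc n) ^^ n"
    using refl[OF assms(1)] by (auto simp: relpow_fun_conv)
  ultimately have "(x, y) \<in> K (Suc n) ^^ Suc n"
    by auto
  then show ?thesis
    unfolding chain_dist_def by (rule LeastI)
qed

lemma chain_dist_self: "chain_dist x x = 0"
  using chain_dist_le[of x x 0] by simp

lemma chain_dist_commute: "chain_dist x y = chain_dist y x"
proof -
  have "(x, y) \<in> K n ^^ n \<longleftrightarrow> (y, x) \<in> K n ^^ n" for n
    using sym_relpow[OF sym] by (blast dest: symD)
  then show ?thesis
    by (simp add: chain_dist_def)
qed

lemma chain_dist_triangle:
  assumes "x \<in> X" "y \<in> X" "z \<in> X"
  shows "chain_dist x z \<le> chain_dist x y + chain_dist y z"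
proof -
  let ?m = "chain_dist x y" and ?n = "chain_dist y z"
  have "K ?m \<subseteq> K (?m + ?n)" "K ?n \<subseteq> K (?m + ?n)"
    using mono by (simp_all add: monoD)
  then have "(x, y) \<in> K (?m + ?n) ^^ ?m" "(y, z) \<in> K (?m + ?n) ^^ ?n"
    using relpow_image[OF chain_dist_attained, of _ _ "\<lambda>u. u"] assms by (meson subsetD)+
  then show ?thesis
    by (intro chain_dist_le relpow_trans)
qed

lemma Metric_space_chain_dist: "Metric_space X (\<lambda>x y. real (chain_dist x y))"
proof
  show "real (chain_dist x y) = 0 \<longleftrightarrow> x = y" if "x \<in> X" "y \<in> X" for x y
    using chain_dist_attained[OF that] chain_dist_self by auto
  show "real (chain_dist x z) \<le> real (chain_dist x y) + real (chain_dist y z)"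
    if "x \<in> X" "y \<in> X" "z \<in> X" for x y z
    using chain_dist_triangle[OF that] by linarith
qed (simp_all add: chain_dist_commute)

lemma finite_chain_dist_ball:
  assumes "x \<in> X"
  shows "finite {y \<in> X. real (chain_dist x y) \<le> r}"
proof (rule finite_subset)
  show "{y \<in> X. real (chain_dist x y) \<le> r} \<subseteq> (\<Union>n\<le>nat \<lfloor>r\<rfloor>. (K n ^^ n) `` {x})"
    using chain_dist_attained[OF assms] by (fastforce simp: le_nat_floor)
  show "finite (\<Union>n\<le>nat \<lfloor>r\<rfloor>. (K n ^^ n) `` {x})"
    by (simp add: finite_Image_relpow finite_fibre)
qed

lemma locally_finite_metric_chain_dist:
  "locally_finite_metric X (\<lambda>x y. real (chain_dist x y))"
proof -
  interpret Metric_space X "\<lambda>x y. real (chain_dist x y)"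
    by (rule Metric_space_chain_dist)
  have "openin mtopology {x}" if "x \<in> X" for x
  proof -
    \<comment> \<open>Distances are integers, so the open unit balls are the points.\<close>
    have "mball x 1 = {x}"
      using that zero by (auto simp: chain_dist_self)
    then show ?thesis
      using openin_mball by metis
  qed
  then have "discrete_topology X = mtopology"
    by (simp add: discrete_topology_unique)
  moreover have "compactin mtopology (mcball x r)" if "x \<in> X" for x r
  proof (rule finite_imp_compactin)
    show "finite (mcball x r)"
      using finite_chain_dist_ball[OF that, of r] that by (simp add: mcball_def)
  qed auto
  ultimately show ?thesis
    by (simp add: locally_finite_metric_def Metric_space_axioms)
qed

end

section \<open>Group actions with finite stabilizer orbits\<close>

context group_action
begin

text \<open>
  Invariance follows from its one-sided form, since the inverse of a group element undoes it.
\<close>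

lemma invariantI:
  fixes d :: "'c \<Rightarrow> 'c \<Rightarrow> 'd::order"
  assumes nonexpansive:
      "\<And>g x y. g \<in> carrier G \<Longrightarrow> x \<in> E \<Longrightarrow> y \<in> E \<Longrightarrow> d (\<phi> g x) (\<phi> g y) \<le> d x y"
    and "g \<in> carrier G" "x \<in> E" "y \<in> E"
  shows "d (\<phi> g x) (\<phi> g y) = d x y"
proof (rule antisym)
  interpret group G
    using group_hom group_hom.axioms(1) by auto
  show "d (\<phi> g x) (\<phi> g y) \<le> d x y"
    using assms by blast
  have "\<phi> g x \<in> E" "\<phi> g y \<in> E"
    using assms(2-4) element_image by blast+
  then have "d (\<phi> (inv g) (\<phi> g x)) (\<phi> (inv g) (\<phi> g y)) \<le> d (\<phi> g x) (\<phi> g y)"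
    using assms(2) by (intro nonexpansive) auto
  then show "d x y \<le> d (\<phi> g x) (\<phi> g y)"
    using assms(2-4) orbit_sym_aux by simp
qed

text \<open>
  Two elements \<open>g\<close>, \<open>h\<close> carrying \<open>x\<close> to \<open>a\<close> differ by the element \<open>inv g \<otimes> h\<close> of the stabilizer of \<open>x\<close>.
  So after fixing one such \<open>h\<close>, the preimages of \<open>b\<close> under all of them lie in the stabilizer orbit
  of the preimage of \<open>b\<close> under \<open>h\<close>.
\<close>

lemma finite_common_translates:
  assumes stab: "\<And>y. y \<in> E \<Longrightarrow> finite {\<phi> g y | g. g \<in> stabilizer G \<phi> x}"
    and "x \<in> E"
  shows "finite {y \<in> E. \<exists>g\<in>carrier G. \<phi> g x = a \<and> \<phi> g y = b}" (is "finite ?T")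
proof (cases "?T = {}")
  case False
  interpret group G
    using group_hom group_hom.axioms(1) by auto
  from False obtain z h where z: "z \<in> E" and h: "h \<in> carrier G" "\<phi> h x = a" "\<phi> h z = b"
    by blast
  have "?T \<subseteq> {\<phi> g z | g. g \<in> stabilizer G \<phi> x}"
  proof
    fix y assume "y \<in> ?T"
    then obtain g where y: "y \<in> E" and g: "g \<in> carrier G" "\<phi> g x = a" "\<phi> g y = b"
      by blast
    have "\<phi> (inv g \<otimes> h) x = x" "\<phi> (inv g \<otimes> h) z = y"
      using g h y z \<open>x \<in> E\<close> orbit_sym_aux by (simp_all add: composition_rule)
    then show "y \<in> {\<phi> g z | g. g \<in> stabilizer G \<phi> x}"
      using g h by (force simp: stabilizer_def)
  qed
  then show ?thesis
    using stab[OF z] finite_subset by blast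
next
  case True
  then show ?thesis
    by (simp only: finite.emptyI)
qed

text \<open>
  For \<open>A \<subseteq> E\<close> this is the least reflexive invariant relation on \<open>E\<close> that contains \<open>A \<times> A\<close>: the
  diagonal together with all translates of \<open>A \<times> A\<close>.
\<close>

definition joint_translation :: "'c set \<Rightarrow> ('c \<times> 'c) set"
  where "joint_translation A =
    {(x, y) \<in> E \<times> E. x = y \<or> (\<exists>g\<in>carrier G. \<phi> g x \<in> A \<and> \<phi> g y \<in> A)}"

lemma joint_translation_invariant:
  assumes "(x, y) \<in> joint_translation A" "h \<in> carrier G"
  shows "(\<phi> h x, \<phi> h y) \<in> joint_translation A"
proof (cases "x = y")
  case True
  then show ?thesis
    using assms element_image by (auto simp: joint_translation_def)
next
  case False
  interpret group G
    using group_hom group_hom.axioms(1) by auto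
  obtain g where xy: "x \<in> E" "y \<in> E" and g: "g \<in> carrier G" "\<phi> g x \<in> A" "\<phi> g y \<in> A"
    using False assms by (auto simp: joint_translation_def)
  have "\<phi> (g \<otimes> inv h) (\<phi> h u) = \<phi> g u" if "u \<in> E" for u
    using that g assms(2) orbit_sym_aux[OF assms(2) that refl] element_image
    by (metis composition_rule inv_closed)
  then have "\<phi> (g \<otimes> inv h) (\<phi> h x) \<in> A" "\<phi> (g \<otimes> inv h) (\<phi> h y) \<in> A"
    using xy g by simp_all
  moreover have "g \<otimes> inv h \<in> carrier G" "\<phi> h x \<in> E" "\<phi> h y \<in> E"
    using xy g(1) assms(2) element_image by blast+
  ultimately show ?thesis
    unfolding joint_translation_def by blast
qed

lemma finite_joint_translation_fibre:
  assumes stab: "\<And>x y. x \<in> E \<Longrightarrow> y \<in> E \<Longrightarrow> finite {\<phi> g y | g. g \<in> stabilizer G \<phi> x}"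
    and "finite A"
  shows "finite (joint_translation A `` {x})"
proof (cases "x \<in> E")
  case True
  let ?T = "\<lambda>a b. {y \<in> E. \<exists>g\<in>carrier G. \<phi> g x = a \<and> \<phi> g y = b}"
  have "joint_translation A `` {x} \<subseteq> {x} \<union> (\<Union>a\<in>A. \<Union>b\<in>A. ?T a b)"
    by (auto simp: joint_translation_def)
  moreover have "finite ({x} \<union> (\<Union>a\<in>A. \<Union>b\<in>A. ?T a b))"
    using \<open>finite A\<close> finite_common_translates[OF stab True] True by simp
  ultimately show ?thesis
    by (rule finite_subset)
next
  case False
  then have "joint_translation A `` {x} = {}"
    by (auto simp: joint_translation_def)
  then show ?thesis
    by simp
qed

lemma invariant_locally_finite_metric_exists:
  assumes "countable E"
    and stab: "\<And>x y. x \<in> E \<Longrightarrow> y \<in> E \<Longrightarrow> finite {\<phi> g y | g. g \<in> stabilizer G \<phi> x}"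
  shows "\<exists>d. invariant_metric G \<phi> E d \<and> locally_finite_metric E d"
proof -
  obtain f :: "'c \<Rightarrow> nat" where f: "inj_on f E"
    using assms(1) by (rule countableE)
  define A where "A n = {x \<in> E. f x < n}" for n
  define K where "K n = joint_translation (A n)" for n
  have fin_A: "finite (A n)" for n
  proof (rule inj_on_finite)
    show "inj_on f (A n)"
      using f by (rule inj_on_subset) (auto simp: A_def)
    show "f ` A n \<subseteq> {..<n}"
      by (auto simp: A_def)
  qed simp
  interpret locally_finite_exhaustion E K
  proof
    show "sym (K n)" for n
      by (auto simp: K_def joint_translation_def intro!: symI)
    show "mono K"
      by (rule monoI) (fastforce simp: K_def A_def joint_translation_def)
    show "finite (K n `` {x})" for n x
      unfolding K_def using stab fin_A by (rule finite_joint_translation_fibre)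
    show "\<exists>n. (x, y) \<in> K n" if "x \<in> E" "y \<in> E" for x y
    proof -
      interpret group G
        using group_hom group_hom.axioms(1) by auto
      have "\<phi> \<one> x = x" "\<phi> \<one> y = y"
        using that id_eq_one by (metis restrict_apply')+
      then have "(x, y) \<in> K (Suc (max (f x) (f y)))"
        using that by (auto simp: K_def A_def joint_translation_def intro!: bexI[of _ \<one>])
      then show ?thesis ..
    qed
  qed (simp add: K_def joint_translation_def)
  have "chain_dist (\<phi> g x) (\<phi> g y) \<le> chain_dist x y" if "g \<in> carrier G" "x \<in> E" "y \<in> E" for g x y
    using relpow_image[OF chain_dist_attained[OF that(2,3)], of "\<phi> g"]
      joint_translation_invariant that(1)
    by (intro chain_dist_le) (auto simp: K_def)
  then have "invariant_metric G \<phi> E (\<lambda>x y. real (chain_dist x y))"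
    by (simp add: invariant_metric_def Metric_space_chain_dist invariantI[of chain_dist])
  then show ?thesis
    using locally_finite_metric_chain_dist by blast
qed

lemma finite_stabilizer_orbit:
  assumes inv: "invariant_metric G \<phi> E d" and lf: "locally_finite_metric E d"
    and "x \<in> E" "y \<in> E"
  shows "finite {\<phi> g y | g. g \<in> stabilizer G \<phi> x}"
proof (rule finite_subset)
  interpret Metric_space E d
    using inv by (simp add: invariant_metric_def)
  have "compactin (discrete_topology E) (mcball x (d x y))"
    using lf \<open>x \<in> E\<close> by (metis locally_finite_metric_def)
  then show "finite (mcball x (d x y))"
    by (simp add: compactin_discrete_topology)
  have "d x (\<phi> g y) = d x y" "\<phi> g y \<in> E" if "g \<in> stabilizer G \<phi> x" for g
  proof -
    have g: "g \<in> carrier G" "\<phi> g x = x"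
      using that by (auto simp: stabilizer_def)
    then have "d (\<phi> g x) (\<phi> g y) = d x y"
      using inv \<open>x \<in> E\<close> \<open>y \<in> E\<close> unfolding invariant_metric_def by blast
    with g show "d x (\<phi> g y) = d x y"
      by simp
    show "\<phi> g y \<in> E"
      using g(1) \<open>y \<in> E\<close> element_image by blast
  qed
  then show "{\<phi> g y | g. g \<in> stabilizer G \<phi> x} \<subseteq> mcball x (d x y)"
    using \<open>x \<in> E\<close> by auto
qed

end

theorem proposition3p3:
  fixes G :: "('g, 'm) monoid_scheme" and X :: "'a set" and \<phi> :: "'g \<Rightarrow> 'a \<Rightarrow> 'a"
  assumes "group_action G X \<phi>"
    and "countable X"
  shows "(\<exists>d. invariant_metric G \<phi> X d \<and> locally_finite_metric X d) \<longleftrightarrow>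
    (\<forall>x\<in>X. \<forall>y\<in>X. finite {\<phi> g y | g. g \<in> stabilizer G \<phi> x})"
  using group_action.finite_stabilizer_orbit[OF assms(1)]
    group_action.invariant_locally_finite_metric_exists[OF assms]
  by blast

end
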